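(* Let $r\ge 0$ be a fixed integer and, for $0\le k\le r$, put $$A(r,k)=\sum_{i=0}^{r}\frac{(-1)^i}{(k-i)!}\binom{r}{i},$$ where $\frac{1}{(k-i)!}$ is interpreted as $0$ when $i>k$. Then for every real $\varepsilon>0$, $$\frac{D_r(n)}{n!}=\frac{1}{e}\sum_{k=0}^{r}A(r,k)\binom{n+r-k}{n}+O(\varepsilon^n)\qquad(n\to\infty).$$
   Context: For integers $n,r\ge 0$, the $r$-derangement number $D_r(n)$ is the number of permutations of $\{1,\dots,n+r\}$ that have no fixed points and in whose cycle decomposition the elements $1,\dots,r$ lie in pairwise distinct cycles. Here $e$ is the base of the natural logarithm. The constant implied by $O(\varepsilon^n)$ may depend on $r$ and $\varepsilon$ but not on $n$. *)

theory Defs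
  imports
    Complex_Main
    "HOL-Library.Landau_Symbols"
    "HOL-Combinatorics.Orbits"
begin

text \<open>
  The cycle of \<^term>\<open>p\<close> containing \<^term>\<open>i\<close> is represented by its
  underlying set \<^term>\<open>orbit p i\<close>.
\<close>
definition r_derangements :: "nat \<Rightarrow> nat \<Rightarrow> (nat \<Rightarrow> nat) set" where
  "r_derangements r n =
     {p. p permutes {1..n + r} \<and>
         (\<forall>x\<in>{1..n + r}. p x \<noteq> x) \<and>
         (\<forall>i\<in>{1..r}. \<forall>j\<in>{1..r}. i \<noteq> j \<longrightarrow> orbit p i \<noteq> orbit p j)}"

definition r_derangement_number :: "nat \<Rightarrow> nat \<Rightarrow> nat" where
  "r_derangement_number r n = card (r_derangements r n)"

definition A_coeff :: "nat \<Rightarrow> nat \<Rightarrow> real" where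
  "A_coeff r k =
     (\<Sum>i=0..r. (- 1) ^ i * (if i \<le> k then 1 / fact (k - i) else 0) * real (r choose i))"

end

theory Submission
  imports Defs "HOL-Computational_Algebra.Formal_Power_Series"
begin

text \<open>
  Inserting the elements of \<open>B\<close> one at a time into the cycles shows that \<open>(a + b)! / a!\<close>
  permutations of \<open>A \<union> B\<close> (\<open>card A = a\<close>, \<open>card B = b\<close>) have the elements of \<open>A\<close> in distinct
  cycles. Inclusion-exclusion over the set of fixed points then gives \<open>D\<^sub>r(n) / n!\<close> as
  the coefficient of \<open>x\<^sup>n\<close> in \<open>e\<^bsup>-x\<^esup> (1 - x)\<^bsup>-r-1\<^esup> \<Sum>\<^sub>i (-1)\<^sup>i (r choose i) (1 - x)\<^sup>i\<close>.
  Expanding \<open>e\<^bsup>-x\<^esup> = e\<^sup>-\<^sup>1 \<Sum>\<^sub>k (1 - x)\<^sup>k / k!\<close>, the terms with a negative total power of \<open>1 - x\<close> are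
  the main term, and the others contribute at most \<open>2\<^sup>r / n!\<close>, because
  \<open>\<Sum>\<^sub>k (k choose n) / k! = e / n!\<close>.
\<close>

section \<open>Counting permutations with separated cycles\<close>

text \<open>Arbitrary sets replace the intervals because the count inserts points into
  \<open>B\<close>, while inclusion-exclusion deletes points from both sets.\<close>

definition separating_perms :: "'a set \<Rightarrow> 'a set \<Rightarrow> ('a \<Rightarrow> 'a) set" where
  "separating_perms A B = {p. p permutes (A \<union> B) \<and> inj_on (orbit p) A}"

section \<open>Inserting a point into a cycle\<close>

text \<open>Composing with \<open>transpose b c\<close> inserts the fixed point \<open>b\<close>
  just before \<open>c\<close>: an arrow \<open>y -> c\<close> becomes \<open>y -> b -> c\<close>.
  So a step of \<open>p\<close> from \<open>y\<close> other than \<open>b\<close> is one or two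
  steps of the new map.\<close>

lemma orbit_subset_transpose_comp:
  assumes "inj p" "p b = b" "a \<noteq> b" "x \<in> orbit p a"
  shows "x \<in> orbit (transpose b c \<circ> p) a"
proof -
  let ?q = "transpose b c \<circ> p"
  have step: "p y \<in> orbit ?q a" if "y = a \<or> y \<in> orbit ?q a" for y
  proof -
    have qy: "?q y \<in> orbit ?q a" using that
      by (elim disjE, hypsubst, intro orbit.base, intro orbit.step)
    then have qqy: "?q (?q y) \<in> orbit ?q a" by (rule orbit.step)
    consider "p y = b" | "p y \<noteq> b" "p y = c" | "p y \<noteq> b" "p y \<noteq> c" by blast
    then show ?thesis
    proof cases
      case 1
      then have "y = b" using assms(1,2) by (metis injD)
      then have "y \<in> orbit ?q a" using that assms(3) by blast
      then show ?thesis using \<open>y = b\<close> assms(2) by simp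
    next
      case 2
      then show ?thesis using qqy assms(2) by simp
    next
      case 3
      then show ?thesis using qy by simp
    qed
  qed
  from assms(4) show ?thesis
    by induction (rule step, simp only: simp_thms)+
qed

lemma orbit_transpose_comp:
  assumes "inj p" "p b = b" "a \<noteq> b" "x \<noteq> b"
  shows "x \<in> orbit (transpose b c \<circ> p) a \<longleftrightarrow> x \<in> orbit p a"
proof
  let ?q = "transpose b c \<circ> p"
  have pb: "p y = b \<longleftrightarrow> y = b" for y using assms(1,2) by (metis injD)
  assume "x \<in> orbit ?q a"
  \<comment> \<open>The induction must survive a visit to \<open>b\<close>, from where
    \<open>?q\<close> goes on to \<open>c\<close>; hence the second conjunct.\<close>
  then have "(x \<noteq> b \<longrightarrow> x \<in> orbit p a) \<and> (x = b \<longrightarrow> c = b \<or> c \<in> orbit p a)"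
  proof induction
    case base
    then show ?case using assms(3) pb orbit.base[of p a] by (auto simp: transpose_def)
  next
    case (step y)
    then show ?case using pb orbit.step[of y p a] assms(2)
      by (auto simp: transpose_def split: if_splits)
  qed
  then show "x \<in> orbit p a" using assms(4) by simp
qed (rule orbit_subset_transpose_comp[OF assms(1-3)])

text \<open>\<open>orbit p b\<close> starts at \<open>p b\<close>, so that it contains
  \<open>b\<close> itself relies on finiteness; after that, orbits partition the points.\<close>

lemma orbit_eq_iff_mem:
  assumes "p permutes S" "finite S"
  shows "orbit p a = orbit p b \<longleftrightarrow> a \<in> orbit p b"
proof -
  have "permutation p" using assms permutation_permutes by blast
  then have self: "x \<in> orbit p x" for x by (rule permutation_self_in_orbit)
  show ?thesis
    using self orbit_trans[of _ p a b] orbit_trans[of _ p b a] orbit_swap[OF self, of a b] by blast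
qed

lemma inj_on_orbit_transpose_comp:
  assumes "finite S" "p permutes S" "b \<notin> S" "c \<in> insert b S" "A \<subseteq> S"
  shows "inj_on (orbit (transpose b c \<circ> p)) A \<longleftrightarrow> inj_on (orbit p) A"
proof -
  have perm: "(transpose b c \<circ> p) permutes insert b S"
    by (rule permutes_compose[OF permutes_subset[OF assms(2)] permutes_swap_id]) (use assms(4) in auto)
  have "orbit (transpose b c \<circ> p) x = orbit (transpose b c \<circ> p) y \<longleftrightarrow> orbit p x = orbit p y"
    if "x \<in> A" "y \<in> A" for x y
  proof -
    have "x \<noteq> b" "y \<noteq> b" using that assms by auto
    then show ?thesis
      unfolding orbit_eq_iff_mem[OF assms(2,1)] orbit_eq_iff_mem[OF perm finite.insertI[OF assms(1)]]
      using orbit_transpose_comp[of p b y x c] permutes_inj[OF assms(2)]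
        permutes_not_in[OF assms(2,3)] by simp
  qed
  then show ?thesis unfolding inj_on_def by blast
qed

text \<open>A permutation of \<open>insert b S\<close> is some \<open>transpose b c\<close> after a
  permutation of \<open>S\<close>. The choice \<open>c = b\<close> makes \<open>b\<close> a cycle of
  its own, the others put it into an existing cycle; neither merges cycles of points of
  \<open>A\<close>.\<close>

lemma separating_perms_insert:
  assumes "finite (A \<union> B)" "b \<notin> A \<union> B"
  shows "separating_perms A (insert b B) =
    (\<lambda>(c, p). transpose b c \<circ> p) ` (insert b (A \<union> B) \<times> separating_perms A B)"
proof -
  have sep_eq: "transpose b c \<circ> q \<in> separating_perms A (insert b B) \<longleftrightarrow> q \<in> separating_perms A B"
    if "q permutes (A \<union> B)" "c \<in> insert b (A \<union> B)" for q c
  proof -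
    have "(transpose b c \<circ> q) permutes insert b (A \<union> B)"
      by (rule permutes_compose[OF permutes_subset[OF that(1)] permutes_swap_id]) (use that(2) in auto)
    then show ?thesis
      using inj_on_orbit_transpose_comp[OF assms(1) that(1) assms(2) that(2), of A] that(1)
      unfolding separating_perms_def by simp
  qed
  show ?thesis
  proof (intro equalityI subsetI)
    fix p assume p: "p \<in> separating_perms A (insert b B)"
    then have "p \<in> {p. p permutes insert b (A \<union> B)}" unfolding separating_perms_def by simp
    then obtain c q where cq: "p = transpose b c \<circ> q" "c \<in> insert b (A \<union> B)" "q permutes (A \<union> B)"
      unfolding permutes_insert by auto
    then have "q \<in> separating_perms A B" using p sep_eq[OF cq(3,2)] by simp
    then show "p \<in> (\<lambda>(c, p). transpose b c \<circ> p) ` (insert b (A \<union> B) \<times> separating_perms A B)"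
      using cq by (intro image_eqI[where x="(c, q)"]) auto
  next
    fix p assume "p \<in> (\<lambda>(c, p). transpose b c \<circ> p) ` (insert b (A \<union> B) \<times> separating_perms A B)"
    then obtain c q where cq: "p = transpose b c \<circ> q" "c \<in> insert b (A \<union> B)" "q \<in> separating_perms A B"
      by auto
    then show "p \<in> separating_perms A (insert b B)"
      using sep_eq[of q c] by (simp add: separating_perms_def)
  qed
qed

text \<open>Since \<open>x\<close> and \<open>p x\<close> share a cycle, separation of all points
  forces every cycle to be trivial.\<close>

lemma separating_perms_empty:
  assumes "finite A"
  shows "separating_perms A {} = {id}"
proof -
  have "p = id" if p: "p permutes A" "inj_on (orbit p) A" for p
  proof
    fix x
    have "orbit p (p x) = orbit p x"
      using orbit_eq_iff_mem[OF p(1) assms, of "p x" x] orbit.base[of p x] by blast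
    then show "p x = id x"
      using p permutes_in_image[OF p(1), of x] permutes_not_in[OF p(1), of x]
      by (auto simp: inj_on_def)
  qed
  moreover have "inj_on (orbit id) A"
    using orbit_eq_singleton_iff[of id] by (metis id_apply inj_onI singleton_inject)
  ultimately show ?thesis unfolding separating_perms_def by auto
qed

lemma finite_separating_perms:
  "finite (A \<union> B) \<Longrightarrow> finite (separating_perms A B)"
  unfolding separating_perms_def by (rule finite_subset[OF _ finite_permutations]) auto

text \<open>The new point has \<open>card A + card B + 1\<close> choices of \<open>c\<close>, so the
  count is a rising product starting at \<open>card A + 1\<close>.\<close>

lemma card_separating_perms:
  assumes "finite A" "finite B" "A \<inter> B = {}"
  shows "real (card (separating_perms A B)) = fact (card A + card B) / fact (card A)"
  using assms(2,3)
proof (induction B)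
  case empty
  then show ?case using assms(1) by (simp add: separating_perms_empty)
next
  case (insert b B)
  let ?S = "A \<union> B"
  have S: "finite ?S" "b \<notin> ?S" using insert.hyps insert.prems assms(1) by auto
  have "inj_on (\<lambda>(c, p). transpose b c \<circ> p) (insert b ?S \<times> separating_perms A B)"
  proof (rule inj_onI, clarify)
    fix c p d q
    assume pq: "p \<in> separating_perms A B" "q \<in> separating_perms A B"
      and eq: "transpose b c \<circ> p = transpose b d \<circ> q"
    have "p permutes ?S" "q permutes ?S" using pq by (simp_all add: separating_perms_def)
    then have "p b = b" "q b = b" using S(2) by (blast dest: permutes_not_in)+
    \<comment> \<open>Both \<open>p\<close> and \<open>q\<close> fix \<open>b\<close>, so the value
      of the composition at \<open>b\<close> recovers \<open>c\<close>.\<close>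
    then have "c = d" using fun_cong[OF eq, of b] by simp
    moreover from this have "p = q"
      using eq by (metis comp_assoc id_comp transpose_comp_involutory)
    ultimately show "c = d \<and> p = q" by blast
  qed
  then have "card (separating_perms A (insert b B)) = Suc (card ?S) * card (separating_perms A B)"
    using S by (simp add: separating_perms_insert[OF S] card_image card_cartesian_product)
  moreover have "card ?S = card A + card B"
    using insert.prems insert.hyps assms(1) by (intro card_Un_disjoint) auto
  moreover have "real (card (separating_perms A B)) = fact (card A + card B) / fact (card A)"
    using insert.IH insert.prems by simp
  ultimately show ?case using insert.hyps by (simp add: distrib_right add_divide_distrib)
qed

section \<open>Inclusion-exclusion over fixed points\<close>

text \<open>A fixed point is a cycle by itself, hence separated from everything else, and can be
  deleted from the ground set.\<close>

lemma separating_perms_fixing: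
  assumes "finite (A \<union> B)" "U \<subseteq> A \<union> B"
  shows "{p \<in> separating_perms A B. \<forall>u\<in>U. p u = u} = separating_perms (A - U) (B - U)"
proof -
  have U: "(A - U) \<union> (B - U) = (A \<union> B) - U" by blast
  show ?thesis
  proof (intro equalityI subsetI)
    fix p assume p: "p \<in> {p \<in> separating_perms A B. \<forall>u\<in>U. p u = u}"
    then have "p permutes (A \<union> B)" "\<And>x. x \<in> (A \<union> B) - ((A \<union> B) - U) \<Longrightarrow> p x = x"
      unfolding separating_perms_def by auto
    then have "p permutes ((A \<union> B) - U)" by (rule permutes_superset)
    moreover have "inj_on (orbit p) (A - U)"
      using p unfolding separating_perms_def by (auto intro: inj_on_diff)
    ultimately show "p \<in> separating_perms (A - U) (B - U)"
      unfolding separating_perms_def U by simp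
  next
    fix p assume "p \<in> separating_perms (A - U) (B - U)"
    then have perm: "p permutes ((A \<union> B) - U)" and inj: "inj_on (orbit p) (A - U)"
      unfolding separating_perms_def U by simp_all
    have AB: "p permutes (A \<union> B)" by (rule permutes_subset[OF perm]) blast
    have fixed: "p u = u" if "u \<in> U" for u
      using permutes_not_in[OF perm, of u] that by blast
    have mem: "x \<in> orbit p y" if "orbit p x = orbit p y" for x y
      using orbit_eq_iff_mem[OF AB assms(1), of x y] that by blast
    have sing: "orbit p u = {u}" if "u \<in> U" for u
      using fixed[OF that] by (simp add: orbit_eq_singleton_iff)
    have "inj_on (orbit p) A"
    proof (rule inj_onI)
      fix x y assume xy: "x \<in> A" "y \<in> A" "orbit p x = orbit p y"
      consider "x \<in> U" | "y \<in> U" | "x \<in> A - U" "y \<in> A - U" using xy by blast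
      then show "x = y"
      proof cases
        case 1
        then show ?thesis using mem[OF xy(3)[symmetric]] sing[OF 1] by simp
      next
        case 2
        then show ?thesis using mem[OF xy(3)] sing[OF 2] by simp
      next
        case 3
        then show ?thesis using inj_onD[OF inj xy(3)] by blast
      qed
    qed
    then show "p \<in> {p \<in> separating_perms A B. \<forall>u\<in>U. p u = u}"
      unfolding separating_perms_def using AB fixed by simp
  qed
qed

text \<open>Inclusion-exclusion, by expanding the product of \<open>1 - of_bool (p x = x)\<close>
  over \<open>S\<close>.\<close>

lemma card_no_fixpoint:
  assumes "finite X" "finite S"
  shows "real (card {p \<in> X. \<forall>x\<in>S. p x \<noteq> x}) =
    (\<Sum>U\<in>Pow S. (-1) ^ card U * real (card {p \<in> X. \<forall>u\<in>U. p u = u}))"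
proof -
  have ind: "(\<Prod>x\<in>U. of_bool (P x)) = (of_bool (\<forall>x\<in>U. P x) :: real)" if "finite U" for U :: "'a set" and P
    using that by induction auto
  have card: "real (card {p \<in> X. Q p}) = (\<Sum>p\<in>X. of_bool (Q p))" for Q
    using assms(1) by (simp add: of_bool_def sum.If_cases Collect_conj_eq)
  have "(of_bool (\<forall>x\<in>S. p x \<noteq> x) :: real) = (\<Sum>U\<in>Pow S. (-1) ^ card U * of_bool (\<forall>u\<in>U. p u = u))"
    for p
  proof -
    have "(of_bool (\<forall>x\<in>S. p x \<noteq> x) :: real) = (\<Prod>x\<in>S. 1 - of_bool (p x = x))"
      by (simp add: ind[OF assms(2), symmetric] of_bool_not_iff)
    also have "\<dots> = (\<Sum>U\<in>Pow S. (-1) ^ card U * (\<Prod>x\<in>U. of_bool (p x = x)))"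
      by (subst prod_diff_conv_sum[OF assms(2)]) simp
    also have "\<dots> = (\<Sum>U\<in>Pow S. (-1) ^ card U * of_bool (\<forall>u\<in>U. p u = u))"
      using assms(2) by (intro sum.cong refl) (simp add: ind finite_subset)
    finally show ?thesis .
  qed
  then have "real (card {p \<in> X. \<forall>x\<in>S. p x \<noteq> x}) =
      (\<Sum>p\<in>X. \<Sum>U\<in>Pow S. (-1) ^ card U * of_bool (\<forall>u\<in>U. p u = u))"
    by (simp add: card)
  also have "\<dots> = (\<Sum>U\<in>Pow S. (-1) ^ card U * real (card {p \<in> X. \<forall>u\<in>U. p u = u}))"
    by (subst sum.swap) (simp add: card sum_distrib_left)
  finally show ?thesis .
qed

lemma sum_Pow_card:
  fixes g :: "nat \<Rightarrow> real"
  assumes "finite A"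
  shows "(\<Sum>S\<in>Pow A. g (card S)) = (\<Sum>i\<le>card A. real (card A choose i) * g i)"
proof -
  have "(\<Sum>S\<in>Pow A. g (card S)) = (\<Sum>i\<le>card A. \<Sum>S | S \<in> Pow A \<and> card S = i. g (card S))"
    using assms by (intro sum.group[symmetric]) (auto intro: card_mono)
  also have "\<dots> = (\<Sum>i\<le>card A. real (card A choose i) * g i)"
    by (intro sum.cong refl) (simp add: n_subsets[OF assms])
  finally show ?thesis .
qed

text \<open>Serves the inclusion-exclusion sum, whose terms depend only on how many points of
  \<open>U\<close> are distinguished and how many are not.\<close>

lemma sum_Pow_Un_card:
  fixes g :: "nat \<Rightarrow> nat \<Rightarrow> real"
  assumes "finite A" "finite B" "A \<inter> B = {}"
  shows "(\<Sum>U\<in>Pow (A \<union> B). g (card (U \<inter> A)) (card (U \<inter> B))) =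
    (\<Sum>i\<le>card A. real (card A choose i) * (\<Sum>j\<le>card B. real (card B choose j) * g i j))"
proof -
  have "(\<Sum>U\<in>Pow (A \<union> B). g (card (U \<inter> A)) (card (U \<inter> B))) =
      (\<Sum>(S, T)\<in>Pow A \<times> Pow B. g (card S) (card T))"
    using assms(3)
    by (intro sum.reindex_bij_witness[where i="\<lambda>(S, T). S \<union> T" and j="\<lambda>U. (U \<inter> A, U \<inter> B)"]) auto
  also have "\<dots> = (\<Sum>i\<le>card A. real (card A choose i) * (\<Sum>T\<in>Pow B. g i (card T)))"
    by (simp add: sum.cartesian_product[symmetric] sum_Pow_card[OF assms(1), of "\<lambda>i. \<Sum>T\<in>Pow B. g i (card T)"])
  finally show ?thesis by (simp add: sum_Pow_card[OF assms(2)])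
qed

lemma r_derangements_eq:
  "r_derangements r n =
    {p \<in> separating_perms {1..r} {r+1..n+r}. \<forall>x\<in>{1..r} \<union> {r+1..n+r}. p x \<noteq> x}"
proof -
  have "{1..r} \<union> {r+1..n+r} = {1..n+r}" by auto
  then show ?thesis unfolding r_derangements_def separating_perms_def inj_on_def by auto
qed

lemma r_derangement_number_sum:
  "real (r_derangement_number r n) =
    (\<Sum>i\<le>r. real (r choose i) * (\<Sum>j\<le>n. real (n choose j) *
      ((-1) ^ (i + j) * (fact (r - i + (n - j)) / fact (r - i)))))"
proof -
  let ?A = "{1..r}" and ?B = "{r+1..n+r}"
  have disj: "?A \<inter> ?B = {}" by auto
  have card: "card (separating_perms (?A - U) (?B - U)) =
      (fact (r - card (U \<inter> ?A) + (n - card (U \<inter> ?B))) / fact (r - card (U \<inter> ?A)) :: real)" for U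
  proof -
    have "card (?A - U) = r - card (U \<inter> ?A)" "card (?B - U) = n - card (U \<inter> ?B)"
      by (simp_all add: card_Diff_subset_Int Int_commute)
    then show ?thesis using disj by (subst card_separating_perms) auto
  qed
  have cardU: "card U = card (U \<inter> ?A) + card (U \<inter> ?B)" if "U \<subseteq> ?A \<union> ?B" for U
  proof -
    have "U = (U \<inter> ?A) \<union> (U \<inter> ?B)" using that by blast
    moreover have "card ((U \<inter> ?A) \<union> (U \<inter> ?B)) = card (U \<inter> ?A) + card (U \<inter> ?B)"
      using disj by (intro card_Un_disjoint) auto
    ultimately show ?thesis by simp
  qed
  have "real (r_derangement_number r n) = (\<Sum>U\<in>Pow (?A \<union> ?B). (-1) ^ card U *
      real (card {p \<in> separating_perms ?A ?B. \<forall>u\<in>U. p u = u}))"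
    unfolding r_derangement_number_def r_derangements_eq
    by (intro card_no_fixpoint finite_separating_perms) auto
  also have "\<dots> = (\<Sum>U\<in>Pow (?A \<union> ?B). (-1) ^ (card (U \<inter> ?A) + card (U \<inter> ?B)) *
      (fact (r - card (U \<inter> ?A) + (n - card (U \<inter> ?B))) / fact (r - card (U \<inter> ?A))))"
  proof (intro sum.cong refl)
    fix U assume "U \<in> Pow (?A \<union> ?B)"
    then have U: "U \<subseteq> ?A \<union> ?B" by simp
    show "(-1) ^ card U * real (card {p \<in> separating_perms ?A ?B. \<forall>u\<in>U. p u = u}) =
        (-1) ^ (card (U \<inter> ?A) + card (U \<inter> ?B)) *
        (fact (r - card (U \<inter> ?A) + (n - card (U \<inter> ?B))) / fact (r - card (U \<inter> ?A)))"
      unfolding cardU[OF U, symmetric]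
      by (simp only: separating_perms_fixing[OF _ U] finite_Un finite_atLeastAtMost simp_thms card)
  qed
  also have "\<dots> = (\<Sum>i\<le>card ?A. real (card ?A choose i) * (\<Sum>j\<le>card ?B. real (card ?B choose j) *
      ((-1) ^ (i + j) * (fact (r - i + (n - j)) / fact (r - i)))))"
    using disj by (intro sum_Pow_Un_card) auto
  finally show ?thesis by simp
qed

section \<open>The coefficients of the generating function\<close>

text \<open>
  \<open>derangement_coeff m n\<close> is the coefficient of \<open>x\<^sup>n\<close> in \<open>e\<^bsup>-x\<^esup> (1 - x)\<^bsup>-m-1\<^esup>\<close>.
\<close>

definition derangement_coeff :: "nat \<Rightarrow> nat \<Rightarrow> real" where
  "derangement_coeff m n = (\<Sum>j\<le>n. (-1) ^ j / fact j * real ((n - j + m) choose m))"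

text \<open>Cancelling factorials turns the inner sum into a Cauchy product of the coefficients of
  exp(-x) and of a negative power of 1 - x.\<close>

lemma r_derangement_number_over_fact:
  "real (r_derangement_number r n) / fact n =
    (\<Sum>i\<le>r. (-1) ^ i * real (r choose i) * derangement_coeff (r - i) n)"
proof -
  have "real (n choose j) * ((-1) ^ (i + j) * (fact (r - i + (n - j)) / fact (r - i))) / fact n =
      (-1) ^ i * ((-1) ^ j / fact j * real ((n - j + (r - i)) choose (r - i)))"
    if "j \<le> n" for i j
    using that by (simp add: binomial_fact power_add field_simps)
  then have "(\<Sum>j\<le>n. real (n choose j) * ((-1) ^ (i + j) * (fact (r - i + (n - j)) / fact (r - i)))) / fact n =
      (-1) ^ i * derangement_coeff (r - i) n" for i
    unfolding derangement_coeff_def sum_divide_distrib sum_distrib_left by (intro sum.cong refl) simp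
  then show ?thesis
    unfolding r_derangement_number_sum
    by (simp only: sum_divide_distrib[of _ "{..r}"] times_divide_eq_right[symmetric]) (simp add: mult_ac)
qed

text \<open>The exponential series at 1, divided by \<open>fact n\<close> and shifted by
  \<open>n\<close>; the terms with \<open>k < n\<close> vanish.\<close>

lemma choose_over_fact_sums: "(\<lambda>k. real (k choose n) / fact k) sums (exp 1 / fact n)"
proof -
  have "(\<lambda>k. 1 / fact k) sums (exp 1 :: real)"
    using exp_converges[of "1::real"] by (simp add: divide_inverse)
  then have "(\<lambda>k. 1 / fact k / fact n) sums (exp 1 / fact n :: real)"
    by (rule sums_divide)
  moreover have "real ((k + n) choose n) / fact (k + n) = 1 / fact k / fact n" for k
    by (simp add: binomial_fact)
  ultimately have "(\<lambda>k. real ((k + n) choose n) / fact (k + n)) sums (exp 1 / fact n)" by simp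
  then show ?thesis
    by (subst (asm) sums_iff_shift) (simp add: binomial_eq_0)
qed

text \<open>
  The \<open>k\<close>-th summand is the coefficient of \<open>x\<^sup>n\<close> in \<open>(1 - x)\<^bsup>k-m-1\<^esup> / k!\<close>.
\<close>

lemma derangement_coeff_sums:
  "(\<lambda>k. (-1) ^ n * ((real k - real m - 1) gchoose n) / fact k) sums (exp 1 * derangement_coeff m n)"
proof -
  have term_eq: "(-1) ^ n * ((real k - real m - 1) gchoose n) =
      (\<Sum>j\<le>n. (-1) ^ j * real ((n - j + m) choose m) * real (k choose j))" for k
  proof -
    \<comment> \<open>Vandermonde for the upper index \<open>k + (-(m + 1))\<close> compares
      coefficients in the product of (1 - x)^k and (1 - x)^(-m-1).\<close>
    have "(real k - real m - 1) gchoose n =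
        (\<Sum>j\<le>n. (real k gchoose j) * ((- (real m + 1)) gchoose (n - j)))"
      using gbinomial_Vandermonde[of "real k" "- (real m + 1)" n]
      by (simp add: atLeast0AtMost algebra_simps)
    moreover have "(-1) ^ n * ((- (real m + 1)) gchoose (n - j)) = (-1) ^ j * real ((n - j + m) choose m)"
      if "j \<le> n" for j
    proof -
      have "(- (real m + 1)) gchoose (n - j) = (-1) ^ (n - j) * (real (n - j + m) gchoose (n - j))"
        using gbinomial_minus[of "real m + 1" "n - j"] by (simp add: algebra_simps)
      also have "\<dots> = (-1) ^ (n - j) * real ((n - j + m) choose (n - j))"
        by (simp only: binomial_gbinomial)
      also have "(n - j + m) choose (n - j) = (n - j + m) choose m"
        using binomial_symmetric[of m "n - j + m"] by simp
      finally have "(-1) ^ n * ((- (real m + 1)) gchoose (n - j)) =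
          ((-1) ^ n * (-1) ^ (n - j)) * real ((n - j + m) choose m)" by simp
      also have "(-1) ^ n * (-1) ^ (n - j) = ((-1) ^ j :: real)"
        using that by (simp add: power_add[symmetric] minus_one_power_iff)
      finally show ?thesis .
    qed
    ultimately show ?thesis
      by (simp add: sum_distrib_left binomial_gbinomial mult.left_commute mult.commute)
  qed
  \<comment> \<open>The sum over \<open>j\<close> is finite, so the series in \<open>k\<close> may
    be summed separately for each \<open>j\<close>.\<close>
  have "(\<lambda>k. \<Sum>j\<le>n. (-1) ^ j * real ((n - j + m) choose m) * (real (k choose j) / fact k)) sums
      (\<Sum>j\<le>n. (-1) ^ j * real ((n - j + m) choose m) * (exp 1 / fact j))"
    by (intro sums_sum sums_mult choose_over_fact_sums)
  moreover have "(\<Sum>j\<le>n. (-1) ^ j * real ((n - j + m) choose m) * (exp 1 / fact j)) =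
      exp 1 * derangement_coeff m n"
    unfolding derangement_coeff_def sum_distrib_left by (intro sum.cong refl) simp
  ultimately show ?thesis
    unfolding term_eq sum_divide_distrib by simp
qed

section \<open>Main term and error\<close>

text \<open>The series is cut after \<open>k = m\<close>. The head is the main term; the tail is
  dominated by the series with sum \<open>exp 1 / fact n\<close>, and the factor
  \<open>exp 1\<close> cancels.\<close>

lemma derangement_coeff_approx:
  "\<bar>derangement_coeff m n - 1 / exp 1 * (\<Sum>k\<le>m. real ((n + m - k) choose n) / fact k)\<bar> \<le> 1 / fact n"
proof -
  define f where "f k = (-1) ^ n * ((real k - real m - 1) gchoose n) / fact k" for k
  define main where "main = (\<Sum>k\<le>m. real ((n + m - k) choose n) / fact k)"
  have "(\<Sum>k<Suc m. f k) = main"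
    unfolding main_def lessThan_Suc_atMost
  proof (intro sum.cong refl)
    fix k assume "k \<in> {..m}"
    then have "k \<le> m" by simp
    then have "(-1) ^ n * ((real k - real m - 1) gchoose n) = real (n + m - k) gchoose n"
      by (subst gbinomial_negated_upper) (simp add: of_nat_diff algebra_simps)
    then show "f k = real ((n + m - k) choose n) / fact k"
      unfolding f_def by (simp add: binomial_gbinomial)
  qed
  then have tail: "(\<lambda>j. f (j + Suc m)) sums (exp 1 * derangement_coeff m n - main)"
    using derangement_coeff_sums[of n m] unfolding f_def[symmetric]
    by (subst sums_iff_shift) simp
  have "norm (f (j + Suc m)) \<le> real (j choose n) / fact j" for j
  proof -
    \<comment> \<open>Past the cut the upper index is a natural number, so the generalized binomial
      is an ordinary one.\<close>
    have "real (j + Suc m) - real m - 1 = real j" by simp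
    then have "norm (f (j + Suc m)) = real (j choose n) / fact (j + Suc m)"
      unfolding f_def by (simp only: binomial_gbinomial[symmetric]) (simp add: abs_mult)
    also have "\<dots> \<le> real (j choose n) / fact j"
      by (intro divide_left_mono fact_mono mult_pos_pos) auto
    finally show ?thesis .
  qed
  then have "norm (exp 1 * derangement_coeff m n - main) \<le> exp 1 / fact n"
    using norm_suminf_le[of "\<lambda>j. f (j + Suc m)" "\<lambda>j. real (j choose n) / fact j"]
      tail choose_over_fact_sums[of n] by (simp add: sums_iff)
  moreover have "exp 1 * derangement_coeff m n - main = exp 1 * (derangement_coeff m n - 1 / exp 1 * main)"
    by (simp add: right_diff_distrib)
  ultimately have "exp 1 * \<bar>derangement_coeff m n - 1 / exp 1 * main\<bar> \<le> exp 1 * (1 / fact n)"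
    by (simp add: abs_mult)
  then show ?thesis
    unfolding main_def[symmetric] by (simp only: mult_le_cancel_left_pos exp_gt_zero)
qed

text \<open>\<open>A_coeff r k\<close> is the coefficient of y^k in exp(y) (1 - y)^r; undoing this
  convolution by the shift \<open>k\<close> to \<open>k + i\<close> gives the main terms for
  \<open>m = r - i\<close>.\<close>

lemma sum_A_coeff:
  "(\<Sum>k=0..r. A_coeff r k * real ((n + r - k) choose n)) =
    (\<Sum>i\<le>r. (-1) ^ i * real (r choose i) *
      (\<Sum>k\<le>r - i. real ((n + (r - i) - k) choose n) / fact k))"
proof -
  let ?g = "\<lambda>i k. (-1) ^ i * real (r choose i) * (real ((n + r - k) choose n) / fact (k - i))"
  have "(\<Sum>k=0..r. A_coeff r k * real ((n + r - k) choose n)) =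
      (\<Sum>k\<le>r. \<Sum>i\<le>r. if i \<le> k then ?g i k else 0)"
    unfolding A_coeff_def sum_distrib_right atLeast0AtMost by (intro sum.cong refl) simp
  also have "\<dots> = (\<Sum>i\<le>r. \<Sum>k\<le>r. if i \<le> k then ?g i k else 0)"
    by (rule sum.swap)
  also have "\<dots> = (\<Sum>i\<le>r. \<Sum>k\<in>{i..r}. ?g i k)"
    by (intro sum.cong refl sum.mono_neutral_cong_right) auto
  also have "\<dots> = (\<Sum>i\<le>r. \<Sum>k\<le>r - i. (-1) ^ i * real (r choose i) *
      (real ((n + (r - i) - k) choose n) / fact k))"
  proof (rule sum.cong[OF refl])
    fix i assume "i \<in> {..r}"
    then show "(\<Sum>k\<in>{i..r}. ?g i k) = (\<Sum>k\<le>r - i. (-1) ^ i * real (r choose i) *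
        (real ((n + (r - i) - k) choose n) / fact k))"
      by (intro sum.reindex_bij_witness[where i="\<lambda>k. k + i" and j="\<lambda>k. k - i"]) auto
  qed
  finally show ?thesis by (simp add: sum_distrib_left)
qed

text \<open>One term of the positive series for \<open>exp (1 / \<epsilon>)\<close> is at most its
  sum.\<close>

lemma inverse_fact_bigo_power:
  fixes \<epsilon> :: real
  assumes "\<epsilon> > 0"
  shows "(\<lambda>n. 1 / fact n) \<in> O(\<lambda>n. \<epsilon> ^ n)"
proof (rule bigoI[where c="exp (1 / \<epsilon>)"], rule always_eventually, rule allI)
  fix n
  have "(\<lambda>k. (1 / \<epsilon>) ^ k / fact k) sums exp (1 / \<epsilon>)"
    using exp_converges[of "1 / \<epsilon>"] by (simp add: field_simps)
  then have "(\<Sum>k\<in>{n}. (1 / \<epsilon>) ^ k / fact k) \<le> exp (1 / \<epsilon>)"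
    using assms by (intro sum_le_suminf[where f="\<lambda>k. (1 / \<epsilon>) ^ k / fact k", THEN order_trans])
      (auto simp: sums_iff)
  then show "norm (1 / fact n :: real) \<le> exp (1 / \<epsilon>) * norm (\<epsilon> ^ n)"
    using assms by (simp add: field_simps power_divide)
qed

theorem theorem7:
  fixes r :: nat and \<epsilon> :: real
  assumes "\<epsilon> > 0"
  shows "(\<lambda>n. real (r_derangement_number r n) / fact n
            - 1 / exp 1 * (\<Sum>k=0..r. A_coeff r k * real ((n + r - k) choose n)))
         \<in> O(\<lambda>n. \<epsilon> ^ n)"
proof -
  let ?e = "\<lambda>m n. derangement_coeff m n - 1 / exp 1 * (\<Sum>k\<le>m. real ((n + m - k) choose n) / fact k)"
  have "?e m \<in> O(\<lambda>n. 1 / fact n)" for m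
    using derangement_coeff_approx by (intro bigoI[where c=1] always_eventually) simp
  then have "?e m \<in> O(\<lambda>n. \<epsilon> ^ n)" for m
    using inverse_fact_bigo_power[OF assms] by (rule landau_o.big_trans)
  \<comment> \<open>The number of errors and their weights depend on \<open>r\<close> alone, so the
    bound survives summation.\<close>
  then have "(\<lambda>n. \<Sum>i\<le>r. (-1) ^ i * real (r choose i) * ?e (r - i) n) \<in> O(\<lambda>n. \<epsilon> ^ n)"
    by (intro big_sum_in_bigo) (simp only: cmult_in_bigo_iff simp_thms)
  moreover have "(\<Sum>i\<le>r. (-1) ^ i * real (r choose i) * ?e (r - i) n) =
      real (r_derangement_number r n) / fact n
        - 1 / exp 1 * (\<Sum>k=0..r. A_coeff r k * real ((n + r - k) choose n))" for n
    unfolding r_derangement_number_over_fact sum_A_coeff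
    by (simp add: right_diff_distrib sum_subtractf sum_distrib_left mult.left_commute)
  ultimately show ?thesis by simp
qed

end
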